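(* Fix $\delta>0$, suppose $\delta m\le n$ and $\delta n\le m$, and suppose $\tau\delta\le\zeta_{jk}\le\tau$ for all $j,k$ and some $\tau>0$. Define $a_j=\sum_{k=1}^n(\zeta_{jk}^2+\zeta_{jk})$ for $j=1,\dots,m$, $b_k=\sum_{j=1}^m(\zeta_{jk}^2+\zeta_{jk})$ for $k=1,\dots,n$, and $$\Delta=\frac{12}{\delta^{15/2}(\tau^2+\tau)mn}.$$ Let $L\subset\mathbb R^{m+n}$ be a hyperplane not containing the null-space of $q$, and consider the Gaussian probability measure on $L$ with density proportional to $e^{-q}$. Then $|\mathbf E(s_{j_1}+t_{k_1})(s_{j_2}+t_{k_2})|\le\Delta$ if $j_1\ne j_2$ and $k_1\ne k_2$; $|\mathbf E(s_j+t_{k_1})(s_j+t_{k_2})-1/a_j|\le\Delta$ if $k_1\ne k_2$; $|\mathbf E(s_{j_1}+t_k)(s_{j_2}+t_k)-1/b_k|\le\Delta$ if $j_1\ne j_2$; $|\mathbf E(s_j+t_k)^2-1/a_j-1/b_k|\le\Delta$ for all $j,k$.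
   Context: $Z=(\zeta_{jk})$ is the typical matrix of positive integer margins $(R,C)$ (the unique maximizer of $g(X)=\sum_{j,k}((x_{jk}+1)\ln(x_{jk}+1)-x_{jk}\ln x_{jk})$ on the polytope of real non-negative $m\times n$ matrices with row sums $R$ and column sums $C$; its entries are positive). $q:\mathbb R^{m+n}\to\mathbb R$ is $q(s,t)=\frac12\sum_{j,k}(\zeta_{jk}^2+\zeta_{jk})(s_j+t_k)^2$, $(s,t)=(s_1,\dots,s_m;t_1,\dots,t_n)$; its null-space is spanned by $(1,\dots,1;-1,\dots,-1)$. The coordinates $s_j,t_k$ are regarded as random variables on $L$. *)

theory Defs
  imports "HOL-Analysis.Analysis"
begin

text \<open>The index types \<open>'m\<close> and \<open>'n\<close> stand for \<open>{1..m}\<close> and \<open>{1..n}\<close>; an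
  \<open>m \<times> n\<close> matrix is \<open>X :: real^'n^'m\<close> with \<open>X $ j $ k\<close> the entry in row \<open>j\<close>, column \<open>k\<close>,
  and \<open>\<real>\<^sup>m\<^sup>+\<^sup>n\<close> with coordinates \<open>(s, t)\<close> is \<open>(real^'m) \<times> (real^'n)\<close>.\<close>

definition transportation_polytope :: "nat^'m \<Rightarrow> nat^'n \<Rightarrow> (real^'n^'m) set" where
  "transportation_polytope R C =
     {X. (\<forall>j k. 0 \<le> X $ j $ k) \<and>
         (\<forall>j. (\<Sum>k\<in>UNIV. X $ j $ k) = real (R $ j)) \<and>
         (\<forall>k. (\<Sum>j\<in>UNIV. X $ j $ k) = real (C $ k))}"

text \<open>The convention \<open>0 ln 0 = 0\<close> is automatic.\<close>

definition matrix_entropy :: "real^'n^'m \<Rightarrow> real" where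
  "matrix_entropy X =
     (\<Sum>j\<in>UNIV. \<Sum>k\<in>UNIV. (X $ j $ k + 1) * ln (X $ j $ k + 1) - X $ j $ k * ln (X $ j $ k))"

definition is_typical_matrix :: "nat^'m \<Rightarrow> nat^'n \<Rightarrow> real^'n^'m \<Rightarrow> bool" where
  "is_typical_matrix R C Z \<longleftrightarrow>
     Z \<in> transportation_polytope R C \<and>
     (\<forall>X\<in>transportation_polytope R C. X \<noteq> Z \<longrightarrow> matrix_entropy X < matrix_entropy Z)"

definition typical_form :: "real^'n^'m \<Rightarrow> (real^'m) \<times> (real^'n) \<Rightarrow> real" where
  "typical_form Z = (\<lambda>(s, t).
     1/2 * (\<Sum>j\<in>UNIV. \<Sum>k\<in>UNIV. ((Z $ j $ k)\<^sup>2 + Z $ j $ k) * (s $ j + t $ k)\<^sup>2))"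

text \<open>For a quadratic form \<open>q\<close> this is the kernel of the associated symmetric bilinear form
  \<open>(x, y) \<mapsto> (q (x + y) - q x - q y) / 2\<close>.\<close>

definition null_space :: "('a::real_vector \<Rightarrow> real) \<Rightarrow> 'a set" where
  "null_space q = {x. \<forall>y. q (x + y) = q y}"

definition orthonormal_basis_of :: "'a::euclidean_space set \<Rightarrow> 'a set \<Rightarrow> bool" where
  "orthonormal_basis_of L B \<longleftrightarrow>
     pairwise orthogonal B \<and> (\<forall>b\<in>B. norm b = 1) \<and> span B = L"

text \<open>Lebesgue measure of a linear subspace \<open>L\<close>, as a Borel measure on the ambient space
  concentrated on \<open>L\<close>. This is the library's definition of \<open>lborel\<close> with \<open>Basis\<close> replaced by
  an orthonormal basis of \<open>L\<close>; the result does not depend on the chosen basis.\<close>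

definition lborel_subspace :: "'a::euclidean_space set \<Rightarrow> 'a measure" where
  "lborel_subspace L =
     (let B = (SOME B. orthonormal_basis_of L B)
      in distr (\<Pi>\<^sub>M b\<in>B. (lborel :: real measure)) borel (\<lambda>f. \<Sum>b\<in>B. f b *\<^sub>R b))"

definition gaussian_measure_on :: "'a::euclidean_space set \<Rightarrow> ('a \<Rightarrow> real) \<Rightarrow> 'a measure" where
  "gaussian_measure_on L q =
     density (lborel_subspace L)
       (\<lambda>x. ennreal (exp (- q x) / (\<integral>y. exp (- q y) \<partial>lborel_subspace L)))"

end

theory Submission
  imports Defs "HOL-Probability.Distributions" "HOL-Real_Asymp.Real_Asymp"
begin

text \<open>
  Write \<open>w j k = (Z $ j $ k)\<^sup>2 + Z $ j $ k\<close>, and let \<open>B\<close> be the bilinear form with \<open>q x = B x x / 2\<close>.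
  Gaussian integration by parts on \<open>L\<close> shows that \<open>z = E ((x \<bullet> u) x)\<close> satisfies \<open>B v z = v \<bullet> u\<close> for
  all \<open>v\<close> in \<open>L\<close>; if \<open>u\<close> is orthogonal to the null-space this extends to all \<open>v\<close>, as the null-space
  complements \<open>L\<close>. For \<open>u\<close> the coordinate functional \<open>s\<^sub>j + t\<^sub>k\<close> this is a linear system for \<open>z\<close>.
  After subtracting the main terms \<open>1 / a j\<close> and \<open>1 / b k\<close> from \<open>z\<close>, each half of the remainder is,
  up to an error of order \<open>1 / (\<delta>\<^sup>4 (\<tau>\<^sup>2 + \<tau>) m n)\<close>, minus an average of the other half with respect to
  weights of size at least \<open>\<delta>\<^sup>2 / n\<close> (respectively \<open>\<delta>\<^sup>2 / m\<close>). Such averaging contracts the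
  oscillation by the factor \<open>1 - \<delta>\<^sup>2\<close>, which bounds the remainder by
  \<open>2 / (\<delta>\<^sup>6 (\<tau>\<^sup>2 + \<tau>) m n) \<le> \<Delta>\<close>.
\<close>

section \<open>Gaussian integrals on the real line\<close>

lemma integrable_exp_minus_square:
  fixes c :: real
  assumes "c > 0"
  shows "integrable lborel (\<lambda>x::real. exp (- (c * x\<^sup>2)))"
proof -
  define \<sigma> where "\<sigma> = sqrt (1 / (2 * c))"
  have \<sigma>: "\<sigma>\<^sup>2 = 1 / (2 * c)" using assms by (simp add: \<sigma>_def)
  have "exp (- (c * x\<^sup>2)) = sqrt (2 * pi * \<sigma>\<^sup>2) * normal_density 0 \<sigma> x" for x
    using assms unfolding normal_density_def \<sigma> by (simp add: field_simps)
  moreover have "\<sigma> > 0" using assms by (simp add: \<sigma>_def)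
  ultimately show ?thesis
    by simp
qed

text \<open>The integrand is the derivative of minus the affine factor
  \<open>\<alpha> + \<beta> * y\<close> times the exponential, and that product tends to 0 at both
  ends since \<open>e > 0\<close>. This is the one-dimensional case of Gaussian integration by
  parts.\<close>

lemma integral_derivative_affine_gaussian:
  fixes \<alpha> \<beta> c d e :: real
  assumes "e > 0"
  shows "(\<integral>y. ((d + e * y) * (\<alpha> + \<beta> * y) - \<beta>) * exp (- (c + d * y + e * y\<^sup>2 / 2)) \<partial>lborel) = 0"
    (is "(\<integral>y. ?f y \<partial>lborel) = 0")
\<comment> \<open>The integral of a non-integrable function is 0 by convention, which settles the
  other case.\<close>
proof (cases "integrable lborel ?f")
  case True
  define F where "F y = - ((\<alpha> + \<beta> * y) * exp (- (c + d * y + e * y\<^sup>2 / 2)))" for y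
  have "(LBINT y=-\<infinity>..\<infinity>. ?f y) = 0 - 0"
  proof (rule interval_integral_FTC_integrable)
    show "(F has_vector_derivative ?f y) (at y)" for y
      unfolding F_def has_real_derivative_iff_has_vector_derivative[symmetric]
      by (auto intro!: derivative_eq_intros simp: algebra_simps power2_eq_square)
    show "isCont ?f y" for y by (intro continuous_intros) auto
    show "set_integrable lborel (einterval (-\<infinity>) \<infinity>) ?f"
      using True by (simp add: set_integrable_def)
    have "(F \<longlongrightarrow> 0) at_top" "(F \<longlongrightarrow> 0) at_bot"
      unfolding F_def using assms by real_asymp+
    then show "((F \<circ> real_of_ereal) \<longlongrightarrow> 0) (at_right (-\<infinity>))"
      "((F \<circ> real_of_ereal) \<longlongrightarrow> 0) (at_left \<infinity>)"
      by (simp_all add: ereal_tendsto_simps)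
  qed simp
  then show ?thesis
    by (simp add: interval_lebesgue_integral_def set_lebesgue_integral_def)
qed (simp add: not_integrable_integral_eq)

section \<open>Gaussian measures on a linear subspace\<close>

text \<open>Positivity is asked on \<open>L\<close> only, because the form of the theorem is
  degenerate on the whole space.\<close>

locale positive_form_on_subspace =
  fixes L :: "'a::euclidean_space set" and B :: "'a \<Rightarrow> 'a \<Rightarrow> real" and q :: "'a \<Rightarrow> real"
  assumes subspace_L: "subspace L"
    and bilinear_B: "bounded_bilinear B"
    and sym: "B x y = B y x"
    and pos: "x \<in> L \<Longrightarrow> x \<noteq> 0 \<Longrightarrow> 0 < B x x"
    and q_eq: "q x = B x x / 2"
begin

sublocale B: bounded_bilinear B by (rule bilinear_B)

text \<open>The orthonormal basis that \<^const>\<open>lborel_subspace\<close> chooses.\<close>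

definition basis :: "'a set" where
  "basis = (SOME E. orthonormal_basis_of L E)"

lemma orthonormal_basis: "orthonormal_basis_of L basis"
  unfolding basis_def
proof (rule someI_ex)
  show "\<exists>E. orthonormal_basis_of L E"
    using orthonormal_basis_subspace[OF subspace_L] unfolding orthonormal_basis_of_def by metis
qed

lemma span_basis: "span basis = L" and norm_basis: "b \<in> basis \<Longrightarrow> norm b = 1"
  and pairwise_orthogonal_basis: "pairwise orthogonal basis"
  using orthonormal_basis by (auto simp: orthonormal_basis_of_def)

lemma finite_basis: "finite basis"
  using pairwise_orthogonal_basis pairwise_orthogonal_imp_finite by blast

lemma basis_subset: "b \<in> basis \<Longrightarrow> b \<in> L"
  using span_basis span_base by blast

lemma inner_basis: "a \<in> basis \<Longrightarrow> b \<in> basis \<Longrightarrow> a \<bullet> b = (if a = b then 1 else 0)"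
  using pairwise_orthogonal_basis norm_basis
  by (auto simp: pairwise_def orthogonal_def dot_square_norm)

text \<open>Orthonormal coordinates on \<open>L\<close>: integrals over \<open>L\<close> are pulled
  back along this map to the product measure \<open>N\<close>, where Fubini applies.\<close>

definition emb :: "('a \<Rightarrow> real) \<Rightarrow> 'a" where
  "emb f = (\<Sum>b\<in>basis. f b *\<^sub>R b)"

abbreviation N :: "('a \<Rightarrow> real) measure" where
  "N \<equiv> Pi\<^sub>M basis (\<lambda>_. lborel)"

lemma lborel_subspace_eq: "lborel_subspace L = distr N borel emb"
  by (simp add: lborel_subspace_def basis_def Let_def emb_def[abs_def])

lemma measurable_emb [measurable]: "emb \<in> borel_measurable N"
  unfolding emb_def[abs_def] by measurable

lemma emb_in_L: "emb f \<in> L"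
  unfolding emb_def using subspace_L basis_subset
  by (intro subspace_sum subspace_scale) auto

lemma norm_emb: "(norm (emb f))\<^sup>2 = (\<Sum>b\<in>basis. (f b)\<^sup>2)"
proof -
  have "(norm (emb f))\<^sup>2 = (\<Sum>a\<in>basis. \<Sum>b\<in>basis. f a * f b * (b \<bullet> a))"
    by (simp add: power2_norm_eq_inner emb_def inner_sum_left inner_sum_right sum_distrib_left mult.assoc)
  also have "\<dots> = (\<Sum>a\<in>basis. \<Sum>b\<in>basis. if a = b then (f a)\<^sup>2 else 0)"
    by (intro sum.cong refl) (auto simp: inner_basis power2_eq_square)
  also have "\<dots> = (\<Sum>b\<in>basis. (f b)\<^sup>2)"
    using finite_basis by simp
  finally show ?thesis .
qed

text \<open>By compactness \<open>B x x\<close> attains a minimum on the unit sphere of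
  \<open>L\<close>, positive by \<open>pos\<close>; homogeneity carries the bound to all of
  \<open>L\<close>.\<close>

lemma coercive: obtains c where "c > 0" "\<And>x. x \<in> L \<Longrightarrow> c * (norm x)\<^sup>2 \<le> q x"
proof (cases "L \<inter> sphere 0 1 = {}")
  \<comment> \<open>Without unit vectors \<open>L\<close> is the zero space, and any constant
    works.\<close>
  case True
  have "x = 0" if "x \<in> L" for x
  proof (rule ccontr)
    assume "x \<noteq> 0"
    then have "x /\<^sub>R norm x \<in> L \<inter> sphere 0 1"
      using that subspace_L by (auto simp: subspace_scale)
    with True show False by blast
  qed
  then have "1 * (norm x)\<^sup>2 \<le> q x" if "x \<in> L" for x
    using that by (force simp: q_eq B.zero_left)
  then show ?thesis using that[of 1] by simp
next
  case False
  have "compact (L \<inter> sphere 0 1)"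
    using closed_subspace[OF subspace_L] by (simp add: closed_Int_compact)
  moreover have "continuous_on (L \<inter> sphere 0 1) (\<lambda>x. B x x)"
    by (intro B.continuous_on continuous_on_id)
  ultimately obtain x0 where x0: "x0 \<in> L \<inter> sphere 0 1"
    and min: "\<And>x. x \<in> L \<inter> sphere 0 1 \<Longrightarrow> B x0 x0 \<le> B x x"
    using continuous_attains_inf[of "L \<inter> sphere 0 1" "\<lambda>x. B x x"] False by meson
  have "B x0 x0 / 2 * (norm x)\<^sup>2 \<le> q x" if "x \<in> L" for x
  proof (cases "x = 0")
    case False
    then have "x /\<^sub>R norm x \<in> L \<inter> sphere 0 1"
      using that subspace_L by (auto simp: subspace_scale)
    from min[OF this] have "B x0 x0 \<le> B x x / (norm x)\<^sup>2"
      by (simp add: B.scaleR_left B.scaleR_right power2_eq_square field_simps)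
    then show ?thesis using False by (simp add: q_eq field_simps)
  qed (simp add: q_eq B.zero_left)
  moreover have "B x0 x0 / 2 > 0" using pos[of x0] x0 by (cases "x0 = 0") auto
  ultimately show ?thesis using that by blast
qed

lemma measurable_q [measurable]: "q \<in> borel_measurable borel"
proof -
  have "continuous_on UNIV (\<lambda>x. B x x / 2)"
    by (intro continuous_intros B.continuous_on) auto
  then show ?thesis
    using borel_measurable_continuous_onI by (metis (no_types, lifting) ext q_eq)
qed

text \<open>Half of the decay \<open>exp (- c * r)\<close> with \<open>r = (norm x)\<^sup>2\<close>
  absorbs the quadratic growth of \<open>f\<close>; the other half is a product of one-dimensional
  Gaussians in the coordinates.\<close>

lemma integrable_gaussian_N:
  fixes f :: "'a \<Rightarrow> real"
  assumes [measurable]: "f \<in> borel_measurable borel"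
    and bound: "\<And>x. \<bar>f x\<bar> \<le> K * (1 + (norm x)\<^sup>2)"
  shows "integrable N (\<lambda>y. f (emb y) * exp (- q (emb y)))"
proof -
  obtain c where c: "c > 0" "\<And>x. x \<in> L \<Longrightarrow> c * (norm x)\<^sup>2 \<le> q x"
    using coercive by blast
  define K' where "K' = \<bar>K\<bar> * (1 + 2 / c)"
  have dom: "1 + r \<le> (1 + 2 / c) * exp (c / 2 * r)" if "r \<ge> 0" for r
  proof -
    have "1 + c / 2 * r \<le> exp (c / 2 * r)"
      by (rule exp_ge_add_one_self)
    moreover have "1 + r \<le> (1 + 2 / c) * (1 + c / 2 * r)"
      using c(1) that by (simp add: field_simps)
    ultimately show ?thesis
      using c(1) by (meson add_nonneg_nonneg divide_nonneg_pos mult_left_mono order_trans zero_le_numeral zero_le_one)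
  qed
  interpret product_sigma_finite "\<lambda>_::'a. lborel :: real measure" ..
  have "integrable N (\<lambda>y. \<Prod>b\<in>basis. exp (- (c / 2 * (y b)\<^sup>2)))"
    using c(1) by (intro product_integrable_prod finite_basis integrable_exp_minus_square) auto
  then have "integrable N (\<lambda>y. K' * (\<Prod>b\<in>basis. exp (- (c / 2 * (y b)\<^sup>2))))"
    by simp
  then show ?thesis
  proof (rule Bochner_Integration.integrable_bound)
    show "AE y in N. norm (f (emb y) * exp (- q (emb y)))
      \<le> norm (K' * (\<Prod>b\<in>basis. exp (- (c / 2 * (y b)\<^sup>2))))"
    proof (rule AE_I2)
      fix y
      let ?r = "(norm (emb y))\<^sup>2"
      have "\<bar>f (emb y)\<bar> * exp (- q (emb y)) \<le> (\<bar>K\<bar> * (1 + ?r)) * exp (- (c * ?r))"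
        using c(2)[OF emb_in_L] order_trans[OF bound[of "emb y"] mult_right_mono[OF abs_ge_self]]
        by (intro mult_mono) auto
      also have "\<dots> \<le> (\<bar>K\<bar> * ((1 + 2 / c) * exp (c / 2 * ?r))) * exp (- (c * ?r))"
        by (intro mult_right_mono mult_left_mono dom) auto
      also have "\<dots> = K' * exp (- (c / 2 * ?r))"
        by (simp add: K'_def mult_exp_exp)
      also have "exp (- (c / 2 * ?r)) = (\<Prod>b\<in>basis. exp (- (c / 2 * (y b)\<^sup>2)))"
        by (simp add: norm_emb exp_sum[OF finite_basis, symmetric] sum_negf sum_distrib_left)
      finally show "norm (f (emb y) * exp (- q (emb y)))
        \<le> norm (K' * (\<Prod>b\<in>basis. exp (- (c / 2 * (y b)\<^sup>2))))"
        unfolding real_norm_def by (subst abs_mult) (metis abs_exp_cancel abs_ge_self order_trans)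
    qed
  qed measurable
qed

lemma emb_upd: "b \<in> basis \<Longrightarrow> emb (f(b := y)) = emb (f(b := 0)) + y *\<^sub>R b"
  unfolding emb_def
  by (simp add: sum.remove[OF finite_basis] add.commute)

text \<open>\<open>h x * exp (- q x)\<close> is minus the derivative of
  \<open>(x \<bullet> w) * exp (- q x)\<close> in the direction \<open>v\<close>, so its integral
  over \<open>L\<close> should vanish when \<open>v\<close> lies in \<open>L\<close>.\<close>

lemma integrable_by_parts_N:
  fixes v w :: 'a
  defines "h \<equiv> \<lambda>x. B v x * (x \<bullet> w) - v \<bullet> w"
  shows "h \<in> borel_measurable borel"
    and "integrable N (\<lambda>y. h (emb y) * exp (- q (emb y)))"
proof -
  obtain K where K: "K > 0" "\<And>x y. norm (B x y) \<le> norm x * norm y * K"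
    using B.pos_bounded by blast
  have "\<bar>h x\<bar> \<le> (norm v * K * norm w + norm v * norm w) * (1 + (norm x)\<^sup>2)" for x
  proof -
    have "\<bar>B v x * (x \<bullet> w)\<bar> \<le> (norm v * norm x * K) * (norm x * norm w)"
      unfolding abs_mult using K by (intro mult_mono Cauchy_Schwarz_ineq2) auto
    then have "\<bar>h x\<bar> \<le> (norm v * norm x * K) * (norm x * norm w) + norm v * norm w"
      unfolding h_def using Cauchy_Schwarz_ineq2[of v w] by linarith
    also have "\<dots> \<le> (norm v * K * norm w + norm v * norm w) * (1 + (norm x)\<^sup>2)"
      using K(1) by (simp add: algebra_simps power2_eq_square)
    finally show ?thesis .
  qed
  moreover have "continuous_on UNIV h" unfolding h_def
    by (intro continuous_intros B.continuous_on)
  then show "h \<in> borel_measurable borel" by (rule borel_measurable_continuous_onI)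
  ultimately show "integrable N (\<lambda>y. h (emb y) * exp (- q (emb y)))"
    by (intro integrable_gaussian_N)
qed

text \<open>By Fubini the coordinate along \<open>b\<close> can be integrated first, and this inner
  integral is already 0.\<close>

lemma integral_by_parts_basis:
  assumes b: "b \<in> basis"
  shows "(\<integral>y. (B b (emb y) * (emb y \<bullet> w) - b \<bullet> w) * exp (- q (emb y)) \<partial>N) = 0"
proof -
  interpret product_sigma_finite "\<lambda>_::'a. lborel :: real measure" ..
  let ?g = "\<lambda>y. (B b (emb y) * (emb y \<bullet> w) - b \<bullet> w) * exp (- q (emb y))"
  have inner: "(\<integral>y. ?g (f(b := y)) \<partial>lborel) = 0" for f
  proof -
    define x where "x = emb (f(b := 0))"
    have x: "emb (f(b := y)) = x + y *\<^sub>R b" for y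
      unfolding x_def by (rule emb_upd[OF b])
    \<comment> \<open>On the line \<open>x + y *\<^sub>R b\<close> the form \<open>q\<close> is a
      quadratic polynomial in \<open>y\<close> with leading coefficient
      \<open>B b b / 2 > 0\<close>, and the inner product with \<open>w\<close> is affine in
      \<open>y\<close>.\<close>
    have "(\<integral>y. ?g (f(b := y)) \<partial>lborel) =
      (\<integral>y. ((B b x + B b b * y) * (x \<bullet> w + b \<bullet> w * y) - b \<bullet> w) *
        exp (- (B x x / 2 + B b x * y + B b b * y\<^sup>2 / 2)) \<partial>lborel)"
      unfolding x q_eq
      by (simp add: B.add_left B.add_right B.scaleR_left B.scaleR_right inner_add_left
          sym[of x b] power2_eq_square algebra_simps add_divide_distrib)
    also have "\<dots> = 0"
      using pos[OF basis_subset[OF b]] norm_basis[OF b]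
      by (intro integral_derivative_affine_gaussian) (cases "b = 0"; simp)
    finally show ?thesis .
  qed
  have "(\<integral>y. ?g y \<partial>N) =
    (\<integral>f. (\<integral>y. ?g (f(b := y)) \<partial>lborel) \<partial>Pi\<^sub>M (basis - {b}) (\<lambda>_. lborel))"
    using product_integral_insert[of "basis - {b}" b ?g] integrable_by_parts_N(2)[of b w] finite_basis
    by (simp add: insert_absorb[OF b])
  also have "\<dots> = 0"
    by (simp only: inner) simp
  finally show ?thesis .
qed

lemma integral_by_parts_N:
  assumes "v \<in> L"
  shows "(\<integral>y. (B v (emb y) * (emb y \<bullet> w) - v \<bullet> w) * exp (- q (emb y)) \<partial>N) = 0"
proof -
  obtain u where v: "v = (\<Sum>b\<in>basis. u b *\<^sub>R b)"
    using assms span_basis span_finite[OF finite_basis] by auto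
  have "(B v x * (x \<bullet> w) - v \<bullet> w) * r = (\<Sum>b\<in>basis. u b * ((B b x * (x \<bullet> w) - b \<bullet> w) * r))" for x r
    by (simp add: v B.sum_left B.scaleR_left inner_sum_left sum_distrib_left sum_subtractf
        algebra_simps)
  then show ?thesis
    using integrable_by_parts_N(2) by (simp add: integral_by_parts_basis)
qed

definition normalizer :: real where
  "normalizer = (\<integral>x. exp (- q x) \<partial>lborel_subspace L)"

lemma normalizer_eq: "normalizer = (\<integral>y. exp (- q (emb y)) \<partial>N)"
  by (simp add: normalizer_def lborel_subspace_eq integral_distr)

lemma integrable_exp_q: "integrable N (\<lambda>y. exp (- q (emb y)))"
  using integrable_gaussian_N[of "\<lambda>_. 1" 1] by simp

lemma normalizer_pos: "normalizer > 0"
proof -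
  have "normalizer \<noteq> 0"
  proof
    assume "normalizer = 0"
    then have "AE y in N. exp (- q (emb y)) = 0"
      using integral_nonneg_eq_0_iff_AE[OF integrable_exp_q] by (simp add: normalizer_eq)
    then have "emeasure N (space N) = 0"
      by (simp add: AE_iff_measurable[OF _ refl])
    moreover interpret product_sigma_finite "\<lambda>_::'a. lborel :: real measure" ..
    \<comment> \<open>Every factor is infinite, and the empty product is 1, so the total mass is
      never 0.\<close>
    have "emeasure N (space N) = (\<Prod>b\<in>basis. emeasure lborel (UNIV :: real set))"
      using emeasure_PiM[OF finite_basis, of "\<lambda>_. UNIV"] by (simp add: space_PiM)
    ultimately show False using finite_basis by simp
  qed
  moreover have "normalizer \<ge> 0" by (simp add: normalizer_def)
  ultimately show ?thesis by simp
qed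

lemma gaussian_measure_on_eq:
  "gaussian_measure_on L q = density (distr N borel emb) (\<lambda>x. ennreal (exp (- q x) / normalizer))"
  unfolding gaussian_measure_on_def normalizer_def by (simp add: lborel_subspace_eq)

lemma integrable_gaussian:
  fixes f :: "'a \<Rightarrow> real"
  assumes [measurable]: "f \<in> borel_measurable borel"
    and bound: "\<And>x. \<bar>f x\<bar> \<le> K * (1 + (norm x)\<^sup>2)"
  shows "integrable (gaussian_measure_on L q) f"
proof -
  have "integrable N (\<lambda>y. (f (emb y) * exp (- q (emb y))) / normalizer)"
    using integrable_gaussian_N[OF assms] by simp
  then show ?thesis
    using normalizer_pos unfolding gaussian_measure_on_eq
    by (subst integrable_density) (auto simp: integrable_distr_eq mult.commute)
qed

lemma integral_gaussian:
  fixes f :: "'a \<Rightarrow> real"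
  assumes [measurable]: "f \<in> borel_measurable borel"
  shows "(\<integral>x. f x \<partial>gaussian_measure_on L q) = (\<integral>y. f (emb y) * exp (- q (emb y)) \<partial>N) / normalizer"
  using normalizer_pos unfolding gaussian_measure_on_eq
  by (subst integral_density) (auto simp: integral_distr mult.commute)

text \<open>Stein's identity: integration by parts, divided by the normalizing constant.\<close>

lemma covariance_identity_subspace:
  assumes "v \<in> L"
  shows "(\<integral>x. B v x * (x \<bullet> w) \<partial>gaussian_measure_on L q) = v \<bullet> w"
proof -
  have "(\<integral>x. B v x * (x \<bullet> w) \<partial>gaussian_measure_on L q)
    = (\<integral>y. (B v (emb y) * (emb y \<bullet> w) - v \<bullet> w) * exp (- q (emb y)) + v \<bullet> w * exp (- q (emb y)) \<partial>N) / normalizer"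
    using borel_measurable_add[OF integrable_by_parts_N(1)[of v w] borel_measurable_const[of "v \<bullet> w"]]
    by (simp add: integral_gaussian algebra_simps)
  also have "\<dots> = v \<bullet> w"
    using integrable_by_parts_N(2)[of v w] integrable_exp_q normalizer_pos
    by (simp add: integral_by_parts_N[OF assms] normalizer_eq)
  finally show ?thesis .
qed

text \<open>The covariance operator of the Gaussian applied to \<open>w\<close>, that is, the vector
  E((x \<bullet> w) x), assembled from scalar integrals.\<close>

definition cov :: "'a \<Rightarrow> 'a" where
  "cov w = (\<Sum>i\<in>Basis. (\<integral>x. (x \<bullet> w) * (x \<bullet> i) \<partial>gaussian_measure_on L q) *\<^sub>R i)"

lemma integrable_inner_product:
  "integrable (gaussian_measure_on L q) (\<lambda>x. (x \<bullet> w) * (x \<bullet> i))"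
proof (rule integrable_gaussian)
  show "\<bar>(x \<bullet> w) * (x \<bullet> i)\<bar> \<le> norm w * norm i * (1 + (norm x)\<^sup>2)" for x
  proof -
    have "\<bar>(x \<bullet> w) * (x \<bullet> i)\<bar> \<le> (norm x * norm w) * (norm x * norm i)"
      unfolding abs_mult by (intro mult_mono Cauchy_Schwarz_ineq2) auto
    also have "\<dots> \<le> norm w * norm i * (1 + (norm x)\<^sup>2)"
      by (simp add: algebra_simps power2_eq_square)
    finally show ?thesis .
  qed
qed measurable

lemma linear_cov:
  assumes "linear g"
  shows "g (cov w) = (\<integral>x. (x \<bullet> w) * g x \<partial>gaussian_measure_on L q)"
proof -
  interpret g: linear g by fact
  have "g x = (\<Sum>i\<in>Basis. (x \<bullet> i) * g i)" for x
    using g.sum[of "\<lambda>i. (x \<bullet> i) *\<^sub>R i" Basis] by (simp add: euclidean_representation g.scale)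
  then have "(\<integral>x. (x \<bullet> w) * g x \<partial>gaussian_measure_on L q)
      = (\<integral>x. (\<Sum>i\<in>Basis. (x \<bullet> w) * (x \<bullet> i) * g i) \<partial>gaussian_measure_on L q)"
    by (metis (no_types, lifting) mult.assoc sum.cong sum_distrib_left)
  also have "\<dots> = g (cov w)"
    using integrable_inner_product by (simp add: cov_def g.sum g.scale)
  finally show ?thesis by simp
qed

lemma B_cov: "v \<in> L \<Longrightarrow> B v (cov w) = v \<bullet> w"
  using linear_cov[OF bounded_linear.linear[OF B.bounded_linear_right], of v w]
    covariance_identity_subspace[of v w] by (simp add: mult.commute)

lemma B_cov_complement:
  assumes "dim L + 1 = DIM('a)" "x0 \<notin> L" "\<And>y. B x0 y = 0" "x0 \<bullet> w = 0"
  shows "B v (cov w) = v \<bullet> w"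
proof -
  have "dim (insert x0 L) = DIM('a)"
    using assms(1,2) subspace_L by (simp add: dim_insert span_eq_iff[THEN iffD2])
  then have "span (insert x0 L) = UNIV"
    using dim_eq_full by blast
  \<comment> \<open>Subtracting a multiple of \<open>x0\<close> from \<open>v\<close> changes
    neither side of the identity.\<close>
  then obtain k where "v - k *\<^sub>R x0 \<in> L"
    using subspace_L by (metis UNIV_I span_breakdown_eq span_eq_iff)
  from B_cov[OF this, of w] show ?thesis
    using assms(3,4) by (simp add: B.diff_left B.scaleR_left inner_diff_left)
qed

end

section \<open>Contraction of oscillation in a bipartite linear system\<close>

text \<open>The common part \<open>\<kappa>\<close> of the two weight vectors cancels in the difference.\<close>

lemma averaging_contraction:
  fixes p p' y :: "'k::finite \<Rightarrow> real"
  assumes "\<And>k. \<kappa> \<le> p k" "\<And>k. \<kappa> \<le> p' k" "sum p UNIV = 1" "sum p' UNIV = 1"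
    and "\<And>k l. y k - y l \<le> D"
  shows "(\<Sum>k\<in>UNIV. p k * y k) - (\<Sum>k\<in>UNIV. p' k * y k) \<le> (1 - \<kappa> * real CARD('k)) * D"
proof -
  obtain l where l: "\<And>k. y l \<le> y k"
    using arg_min_if_finite(2)[of UNIV y] by (meson UNIV_I UNIV_not_empty finite linorder_not_le)
  \<comment> \<open>Both weight vectors have sum 1, so \<open>y\<close> may be shifted by its
    minimum \<open>y l\<close>; the shifted values lie between 0 and \<open>D\<close>.\<close>
  have "(\<Sum>k\<in>UNIV. p k * y k) - (\<Sum>k\<in>UNIV. p' k * y k)
      = (\<Sum>k\<in>UNIV. p k * y k - p' k * y k - y l * p k + y l * p' k)"
    by (simp add: sum.distrib sum_subtractf sum_distrib_left[symmetric] assms)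
  also have "\<dots> = (\<Sum>k\<in>UNIV. (p k - \<kappa>) * (y k - y l)) - (\<Sum>k\<in>UNIV. (p' k - \<kappa>) * (y k - y l))"
    unfolding sum_subtractf[symmetric] by (intro sum.cong refl) (simp add: algebra_simps)
  also have "\<dots> \<le> (\<Sum>k\<in>UNIV. (p k - \<kappa>) * D) - 0"
    using assms l by (intro diff_mono sum_mono sum_nonneg mult_left_mono mult_nonneg_nonneg) auto
  also have "\<dots> = (1 - \<kappa> * real CARD('k)) * D"
    by (simp add: sum_distrib_right[symmetric] sum_subtractf assms)
  finally show ?thesis .
qed

lemma oscillation_attained:
  fixes x :: "'k::finite \<Rightarrow> real"
  obtains i j where "\<And>k l. x k - x l \<le> x i - x j"
proof -
  have "Max (range x) \<in> range x" "Min (range x) \<in> range x"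
    by (simp_all del: image_iff add: Max_in Min_in)
  then obtain i j where "Max (range x) = x i" "Min (range x) = x j"
    by (metis imageE)
  then have "x k \<le> x i" "x j \<le> x k" for k
    by (metis Max_ge Min_le finite finite_imageI rangeI)+
  then show ?thesis using that[of i j] by (simp add: diff_mono)
qed

text \<open>Dividing equation \<open>j\<close> by its total weight gives \<open>x j\<close> as minus
  an average of \<open>y\<close>, up to an error of at most \<open>U\<close>. In the application
  \<open>M\<close> is the size of the index set of \<open>x\<close>, which makes \<open>U\<close>
  the same when the two sides are exchanged.\<close>

lemma oscillation_step:
  fixes w :: "'j::finite \<Rightarrow> 'k::finite \<Rightarrow> real"
  assumes w: "\<And>j k. \<rho> * W \<le> w j k" "\<And>j k. w j k \<le> W" and "0 < \<rho>" "0 < W"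
    and r: "\<And>j. 0 \<le> r j" "\<And>j. r j \<le> 1 / (\<rho> * M)" and "M > 0"
    and eq: "\<And>j. (\<Sum>k\<in>UNIV. w j k) * x j + (\<Sum>k\<in>UNIV. w j k * y k) = - r j"
    and Y: "\<And>k l. y k - y l \<le> Y"
  defines "U \<equiv> 1 / (\<rho>\<^sup>2 * W * M * real CARD('k))"
  shows "x i - x j \<le> U + (1 - \<rho>) * Y" and "\<bar>x j + y l\<bar> \<le> U + Y"
proof -
  let ?n = "real CARD('k)"
  define a where "a j = (\<Sum>k\<in>UNIV. w j k)" for j
  have n: "?n > 0" by simp
  have a: "\<rho> * W * ?n \<le> a j" "a j \<le> W * ?n" for j
    using sum_mono[of UNIV "\<lambda>_. \<rho> * W" "w j"] sum_mono[of UNIV "w j" "\<lambda>_. W"] w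
    by (simp_all add: a_def mult.commute)
  have a0: "a j > 0" for j
    using a(1)[of j] n assms(3,4) by (meson less_le_trans mult_pos_pos)
  define p where "p j k = w j k / a j" for j k
  have p1: "sum (p j) UNIV = 1" for j
    using a0[of j] by (simp add: p_def sum_divide_distrib[symmetric] a_def)
  have p: "\<rho> / ?n \<le> p j k" for j k
  proof -
    have "\<rho> / ?n = \<rho> * W / (W * ?n)" using assms(4) by simp
    also have "\<dots> \<le> w j k / a j"
      using w a a0 n assms(3,4) by (intro frac_le) (auto intro: order_trans[OF _ w(1)])
    finally show ?thesis by (simp add: p_def)
  qed
  have p0: "0 \<le> p j k" for j k
    using p[of j k] assms(3) n by (meson divide_nonneg_pos order_trans less_imp_le)
  \<comment> \<open>Both bounds matter: errors of one sign differ by at most \<open>U\<close>, not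
    \<open>2 * U\<close>.\<close>
  have u: "0 \<le> r j / a j" "r j / a j \<le> U" for j
  proof -
    have "r j / a j \<le> 1 / (\<rho> * M) / (\<rho> * W * ?n)"
      using r a a0 n assms(3,4,7) by (intro frac_le) (auto intro: order_trans[OF r(1)])
    then show "r j / a j \<le> U" by (simp add: U_def power2_eq_square mult_ac)
    show "0 \<le> r j / a j" using r a0 by (simp add: less_imp_le)
  qed
  have x: "x j = - (r j / a j) - (\<Sum>k\<in>UNIV. p j k * y k)" for j
  proof -
    have "(\<Sum>k\<in>UNIV. p j k * y k) = (\<Sum>k\<in>UNIV. w j k * y k) / a j"
      by (simp add: p_def sum_divide_distrib)
    moreover have "a j * x j = - r j - (\<Sum>k\<in>UNIV. w j k * y k)"
      using eq[of j] by (simp add: a_def)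
    ultimately show ?thesis using a0[of j] by (simp add: field_simps)
  qed
  \<comment> \<open>The lower bound \<open>\<rho> / ?n\<close> on the \<open>?n\<close> weights
    yields the factor \<open>1 - \<rho>\<close>; the minus sign in front of the average exchanges
    \<open>i\<close> and \<open>j\<close>.\<close>
  show "x i - x j \<le> U + (1 - \<rho>) * Y"
    using averaging_contraction[of "\<rho> / ?n" "p j" "p i" y Y, OF p p p1 p1 Y] u(1)[of i] u(2)[of j] n
    unfolding x by simp
  \<comment> \<open>As the weights have sum 1, \<open>y l\<close> can be moved into the average,
    leaving only differences of values of \<open>y\<close>.\<close>
  have yy: "x j + y l = - (r j / a j) + (\<Sum>k\<in>UNIV. p j k * (y l - y k))"
    using p1[of j] by (simp add: x right_diff_distrib sum_subtractf sum_distrib_right[symmetric])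
  have "\<bar>\<Sum>k\<in>UNIV. p j k * (y l - y k)\<bar> \<le> (\<Sum>k\<in>UNIV. p j k * Y)"
    using Y p0 by (intro order_trans[OF sum_abs] sum_mono) (auto simp: abs_mult abs_le_iff intro!: mult_left_mono)
  also have "\<dots> = Y" using p1[of j] by (simp add: sum_distrib_right[symmetric])
  finally show "\<bar>x j + y l\<bar> \<le> U + Y"
    unfolding yy using u[of j] by linarith
qed

text \<open>The system is unchanged when a constant is added to \<open>x\<close> and subtracted from
  \<open>y\<close>, so only the sums \<open>x j + y k\<close> can be bounded. The oscillations of
  \<open>x\<close> and \<open>y\<close> bound each other through \<open>oscillation_step\<close>,
  used once for rows and once for columns.\<close>

lemma bipartite_system_bound:
  fixes w :: "'m::finite \<Rightarrow> 'n::finite \<Rightarrow> real"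
  assumes w: "\<And>j k. \<rho> * W \<le> w j k" "\<And>j k. w j k \<le> W" and \<rho>: "0 < \<rho>" "\<rho> \<le> 1" and W: "0 < W"
    and r: "\<And>j. 0 \<le> r j" "\<And>j. r j \<le> 1 / (\<rho> * real CARD('m))"
    and c: "\<And>k. 0 \<le> c k" "\<And>k. c k \<le> 1 / (\<rho> * real CARD('n))"
    and row: "\<And>j. (\<Sum>k\<in>UNIV. w j k) * x j + (\<Sum>k\<in>UNIV. w j k * y k) = - r j"
    and col: "\<And>k. (\<Sum>j\<in>UNIV. w j k) * y k + (\<Sum>j\<in>UNIV. w j k * x j) = - c k"
  shows "\<bar>x j + y k\<bar> \<le> 2 / (\<rho> ^ 3 * W * real CARD('m) * real CARD('n))"
proof -
  define U where "U = 1 / (\<rho>\<^sup>2 * W * real CARD('m) * real CARD('n))"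
  obtain j1 j2 where X: "\<And>k l. x k - x l \<le> x j1 - x j2"
    using oscillation_attained[of x] by blast
  obtain k1 k2 where Y: "\<And>k l. y k - y l \<le> y k1 - y k2"
    using oscillation_attained[of y] by blast
  let ?X = "x j1 - x j2" and ?Y = "y k1 - y k2"
  have 1: "?X \<le> U + (1 - \<rho>) * ?Y" and 3: "\<bar>x j + y k\<bar> \<le> U + ?Y"
    using oscillation_step[OF w \<rho>(1) W r _ row Y] by (simp_all add: U_def)
  have 2: "?Y \<le> U + (1 - \<rho>) * ?X"
    using oscillation_step(1)[where w="\<lambda>k j. w j k", OF w \<rho>(1) W c _ col X]
    by (simp add: U_def mult_ac)
  have U: "U > 0" using \<rho> W by (simp add: U_def)
  have "?Y \<le> U / \<rho>"
  proof -
    \<comment> \<open>Eliminating \<open>?X\<close> leaves the coefficient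
      \<open>1 - (1 - \<rho>)\<^sup>2 = \<rho> * (2 - \<rho>)\<close> on \<open>?Y\<close>, and the
      positive factor \<open>2 - \<rho>\<close> cancels.\<close>
    have "?Y \<le> U + (1 - \<rho>) * (U + (1 - \<rho>) * ?Y)"
      using 2 mult_left_mono[OF 1, of "1 - \<rho>"] \<rho> by linarith
    then have "(2 - \<rho>) * (\<rho> * ?Y) \<le> (2 - \<rho>) * U"
      by (simp add: algebra_simps)
    then have "\<rho> * ?Y \<le> U" using \<rho> by (simp add: mult_le_cancel_left)
    then show ?thesis using \<rho> by (simp add: field_simps)
  qed
  moreover have "U \<le> U / \<rho>" using U \<rho> by (simp add: field_simps)
  ultimately have "\<bar>x j + y k\<bar> \<le> 2 * (U / \<rho>)" using 3 by linarith
  also have "\<dots> = 2 / (\<rho> ^ 3 * W * real CARD('m) * real CARD('n))"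
    by (simp add: U_def power2_eq_square power3_eq_cube mult_ac)
  finally show ?thesis .
qed

section \<open>The quadratic form of a positive weight matrix\<close>

text \<open>The signless Laplacian form of the complete bipartite graph with edge weights
  \<open>w\<close>.\<close>

definition weighted_form :: "('m::finite \<Rightarrow> 'n::finite \<Rightarrow> real) \<Rightarrow>
    (real^'m) \<times> (real^'n) \<Rightarrow> (real^'m) \<times> (real^'n) \<Rightarrow> real" where
  "weighted_form w x y =
     (\<Sum>j\<in>UNIV. \<Sum>k\<in>UNIV. w j k * (fst x $ j + snd x $ k) * (fst y $ j + snd y $ k))"

lemma bounded_bilinear_weighted_form: "bounded_bilinear (weighted_form w)"
  unfolding bilinear_conv_bounded_bilinear[symmetric] bilinear_def
  by (auto intro!: linearI simp: weighted_form_def algebra_simps sum.distrib sum_distrib_left)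

lemma weighted_form_eq_0_iff:
  assumes "\<And>j k. w j k > 0"
  shows "weighted_form w x x = 0 \<longleftrightarrow> (\<forall>j k. fst x $ j + snd x $ k = 0)"
proof -
  have nn: "0 \<le> w j k * (fst x $ j + snd x $ k) * (fst x $ j + snd x $ k)" for j k
    using assms[of j k] by (simp add: mult.assoc)
  show ?thesis
    using assms unfolding weighted_form_def
    by (auto simp: sum_nonneg_eq_0_iff nn sum_nonneg less_imp_neq[symmetric])
qed

lemma weighted_form_nonneg:
  assumes "\<And>j k. w j k > 0"
  shows "weighted_form w x x \<ge> 0"
  unfolding weighted_form_def using assms
  by (intro sum_nonneg) (simp add: mult.assoc less_imp_le)

text \<open>Testing against unit vectors turns \<open>weighted_form w v z = v \<bullet> u\<close>
  into one equation per row and one per column.\<close>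

lemma weighted_form_axis:
  "weighted_form w (axis j 1, 0) z = (\<Sum>k\<in>UNIV. w j k * (fst z $ j + snd z $ k))"
  "weighted_form w (0, axis k 1) z = (\<Sum>j\<in>UNIV. w j k * (fst z $ j + snd z $ k))"
proof -
  show "weighted_form w (axis j 1, 0) z = (\<Sum>k\<in>UNIV. w j k * (fst z $ j + snd z $ k))"
    unfolding weighted_form_def axis_def
    by (subst sum.swap) (simp add: if_distrib if_distribR mult.assoc cong: if_cong)
  show "weighted_form w (0, axis k 1) z = (\<Sum>j\<in>UNIV. w j k * (fst z $ j + snd z $ k))"
    unfolding weighted_form_def axis_def
    by (simp add: if_distrib if_distribR mult.assoc cong: if_cong)
qed

text \<open>Subtracting \<open>1 / a j0\<close> at \<open>j0\<close> and \<open>1 / b k0\<close> at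
  \<open>k0\<close> cancels the right-hand sides 1. What remains is \<open>- w j k0 / b k0\<close>
  in row \<open>j\<close> and \<open>- w j0 k / a j0\<close> in column \<open>k\<close>; these have
  the sign and size that \<open>bipartite_system_bound\<close> requires.\<close>

lemma bipartite_covariance_bound:
  fixes w :: "'m::finite \<Rightarrow> 'n::finite \<Rightarrow> real" and z :: "(real^'m) \<times> (real^'n)"
  assumes w: "\<And>j k. \<rho> * W \<le> w j k" "\<And>j k. w j k \<le> W" and \<rho>: "0 < \<rho>" "\<rho> \<le> 1" and W: "0 < W"
    and z: "\<And>v. weighted_form w v z = v \<bullet> (axis j0 1, axis k0 1)"
    and a: "\<And>j. a j = (\<Sum>k\<in>UNIV. w j k)" and b: "\<And>k. b k = (\<Sum>j\<in>UNIV. w j k)"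
  shows "\<bar>fst z $ j + snd z $ k - (if j = j0 then 1 / a j0 else 0) - (if k = k0 then 1 / b k0 else 0)\<bar>
    \<le> 2 / (\<rho> ^ 3 * W * real CARD('m) * real CARD('n))"
proof -
  have w0: "0 < w j k" for j k
    using mult_pos_pos[OF \<rho>(1) W] w(1)[of j k] by linarith
  have al: "\<rho> * W * real CARD('n) \<le> a j" for j
    using sum_mono[of UNIV "\<lambda>_. \<rho> * W" "w j"] w by (simp add: a mult.commute)
  have bl: "\<rho> * W * real CARD('m) \<le> b k" for k
    using sum_mono[of UNIV "\<lambda>_. \<rho> * W" "\<lambda>j. w j k"] w by (simp add: b mult.commute)
  have a0: "0 < a j" and b0: "0 < b k" for j k
    unfolding a b using w0 by (auto intro: sum_pos)
  define x where "x j = fst z $ j - (if j = j0 then 1 / a j0 else 0)" for j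
  define y where "y k = snd z $ k - (if k = k0 then 1 / b k0 else 0)" for k
  have sx: "(\<Sum>j\<in>UNIV. w j k * x j) = (\<Sum>j\<in>UNIV. w j k * fst z $ j) - w j0 k / a j0" for k
  proof -
    have "w j k * x j = w j k * fst z $ j - (if j = j0 then w j0 k / a j0 else 0)" for j
      by (simp add: x_def algebra_simps)
    then show ?thesis by (simp add: sum_subtractf)
  qed
  have sy: "(\<Sum>k\<in>UNIV. w j k * y k) = (\<Sum>k\<in>UNIV. w j k * snd z $ k) - w j k0 / b k0" for j
  proof -
    have "w j k * y k = w j k * snd z $ k - (if k = k0 then w j k0 / b k0 else 0)" for k
      by (simp add: y_def algebra_simps)
    then show ?thesis by (simp add: sum_subtractf)
  qed
  have row: "a j * x j + (\<Sum>k\<in>UNIV. w j k * y k) = - (w j k0 / b k0)" for j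
  proof -
    have "a j * fst z $ j + (\<Sum>k\<in>UNIV. w j k * snd z $ k) = (if j = j0 then 1 else 0)"
      using z[of "(axis j 1, 0)"]
      by (simp add: weighted_form_axis a inner_axis_axis algebra_simps sum.distrib sum_distrib_left)
    then show ?thesis
      using a0[of j0] unfolding sy by (simp add: x_def right_diff_distrib split: if_splits)
  qed
  have col: "b k * y k + (\<Sum>j\<in>UNIV. w j k * x j) = - (w j0 k / a j0)" for k
  proof -
    have "b k * snd z $ k + (\<Sum>j\<in>UNIV. w j k * fst z $ j) = (if k = k0 then 1 else 0)"
      using z[of "(0, axis k 1)"]
      by (simp add: weighted_form_axis b inner_axis_axis algebra_simps sum.distrib sum_distrib_left)
    then show ?thesis
      using b0[of k0] unfolding sx by (simp add: y_def right_diff_distrib split: if_splits)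
  qed
  have r: "w j k0 / b k0 \<le> 1 / (\<rho> * real CARD('m))" for j
  proof -
    have "w j k0 / b k0 \<le> W / (\<rho> * W * real CARD('m))"
      using w bl W \<rho> by (intro frac_le) auto
    then show ?thesis using W by simp
  qed
  have c: "w j0 k / a j0 \<le> 1 / (\<rho> * real CARD('n))" for k
  proof -
    have "w j0 k / a j0 \<le> W / (\<rho> * W * real CARD('n))"
      using w al W \<rho> by (intro frac_le) auto
    then show ?thesis using W by simp
  qed
  have "\<bar>x j + y k\<bar> \<le> 2 / (\<rho> ^ 3 * W * real CARD('m) * real CARD('n))"
    using bipartite_system_bound[OF w \<rho> W _ r _ c row[unfolded a] col[unfolded b]] w0 a0 b0
    by (simp add: less_imp_le)
  then show ?thesis
    by (simp add: x_def y_def algebra_simps)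
qed

section \<open>Covariances for the typical matrix\<close>

theorem theorem3p2:
  fixes R :: "nat^'m" and C :: "nat^'n" and Z :: "real^'n^'m"
    and \<delta> \<tau> \<Delta> :: real and a :: "'m \<Rightarrow> real" and b :: "'n \<Rightarrow> real"
    and L :: "((real^'m) \<times> (real^'n)) set" and \<mu> :: "((real^'m) \<times> (real^'n)) measure"
  assumes "\<And>j. R $ j > 0" and "\<And>k. C $ k > 0"
    and "is_typical_matrix R C Z"
    and "\<delta> > 0"
    and "\<delta> * real CARD('m) \<le> real CARD('n)"
    and "\<delta> * real CARD('n) \<le> real CARD('m)"
    and "\<tau> > 0"
    and "\<And>j k. \<tau> * \<delta> \<le> Z $ j $ k \<and> Z $ j $ k \<le> \<tau>"
    and "\<And>j. a j = (\<Sum>k\<in>UNIV. (Z $ j $ k)\<^sup>2 + Z $ j $ k)"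
    and "\<And>k. b k = (\<Sum>j\<in>UNIV. (Z $ j $ k)\<^sup>2 + Z $ j $ k)"
    and "\<Delta> = 12 / (\<delta> powr (15/2) * (\<tau>\<^sup>2 + \<tau>) * real CARD('m) * real CARD('n))"
    and "subspace L" and "dim L + 1 = CARD('m) + CARD('n)"
    and "\<not> null_space (typical_form Z) \<subseteq> L"
    and "\<mu> = gaussian_measure_on L (typical_form Z)"
  shows "(\<forall>j1 j2 k1 k2. j1 \<noteq> j2 \<longrightarrow> k1 \<noteq> k2 \<longrightarrow>
            \<bar>\<integral>(s, t). (s $ j1 + t $ k1) * (s $ j2 + t $ k2) \<partial>\<mu>\<bar> \<le> \<Delta>) \<and>
         (\<forall>j k1 k2. k1 \<noteq> k2 \<longrightarrow>
            \<bar>(\<integral>(s, t). (s $ j + t $ k1) * (s $ j + t $ k2) \<partial>\<mu>) - 1 / a j\<bar> \<le> \<Delta>) \<and>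
         (\<forall>j1 j2 k. j1 \<noteq> j2 \<longrightarrow>
            \<bar>(\<integral>(s, t). (s $ j1 + t $ k) * (s $ j2 + t $ k) \<partial>\<mu>) - 1 / b k\<bar> \<le> \<Delta>) \<and>
         (\<forall>j k. \<bar>(\<integral>(s, t). (s $ j + t $ k)\<^sup>2 \<partial>\<mu>) - 1 / a j - 1 / b k\<bar> \<le> \<Delta>)"
proof -
  define w where "w j k = (Z $ j $ k)\<^sup>2 + Z $ j $ k" for j k
  define W where "W = \<tau>\<^sup>2 + \<tau>"
  define w0 where "w0 j k = ((axis j 1, axis k 1) :: (real^'m) \<times> (real^'n))" for j k
  let ?q = "typical_form Z"
  note Z = assms(8)
  \<comment> \<open>Chaining the two aspect-ratio hypotheses gives \<delta> * \<delta> * m \<le>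
    m.\<close>
  have \<delta>1: "\<delta> \<le> 1"
  proof -
    have "\<delta> * (\<delta> * real CARD('m)) \<le> \<delta> * real CARD('n)"
      using assms(4,5) by (intro mult_left_mono) auto
    then have "\<delta> * \<delta> * real CARD('m) \<le> 1 * real CARD('m)"
      using assms(6) by (simp only: mult_1 mult.assoc)
    then have "\<delta> * \<delta> \<le> 1" by (simp only: mult_le_cancel_right) simp
    then show ?thesis using assms(4) by (smt (verit) mult_less_cancel_left2)
  qed
  have \<rho>: "0 < \<delta>\<^sup>2" "\<delta>\<^sup>2 \<le> 1"
    using \<delta>1 assms(4) by (auto simp: power_le_one)
  have W: "0 < W" using assms(7) by (simp add: W_def add_pos_pos)
  have wW: "w j k \<le> W" for j k
  proof -
    have "0 \<le> Z $ j $ k" using Z[of j k] assms(4,7) by (smt (verit) mult_pos_pos)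
    then show ?thesis
      using Z[of j k] by (auto simp: w_def W_def intro!: add_mono power_mono)
  qed
  \<comment> \<open>Thus \<rho> = \<open>\<delta>\<^sup>2\<close> serves as the ratio of the bounds
    on the weights: the quadratic part of the weight loses \<open>\<delta>\<^sup>2\<close>, the
    linear part only \<delta>, weakened by \<delta> \<le> 1.\<close>
  have Ww: "\<delta>\<^sup>2 * W \<le> w j k" for j k
  proof -
    have "\<delta>\<^sup>2 * \<tau> \<le> \<tau> * \<delta>"
      using \<delta>1 assms(4,7) by (simp add: power2_eq_square)
    moreover have "(\<tau> * \<delta>)\<^sup>2 \<le> (Z $ j $ k)\<^sup>2"
      using Z[of j k] assms(4,7) by (intro power_mono) auto
    ultimately show ?thesis
      using Z[of j k] unfolding w_def W_def by (simp add: power_mult_distrib algebra_simps)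
  qed
  have wpos: "0 < w j k" for j k
    using mult_pos_pos[OF \<rho>(1) W] Ww[of j k] by linarith
  have q: "?q x = weighted_form w x x / 2" for x
    by (simp add: typical_form_def weighted_form_def w_def case_prod_beta power2_eq_square mult.assoc)
  \<comment> \<open>The index \<open>undefined\<close> is just some row.\<close>
  have flat: "fst x = (\<chi> j. c) \<and> snd x = (\<chi> k. - c)"
    if "\<And>j k. fst x $ j + snd x $ k = 0" "c = fst x $ undefined" for x :: "(real^'m) \<times> (real^'n)" and c
    using that by (auto simp: vec_eq_iff) (metis add.commute add_left_cancel add_eq_0_iff)+
  obtain x0 where x0: "x0 \<in> null_space ?q" "x0 \<notin> L" using assms(14) by blast
  \<comment> \<open>The choice y = 0 in the definition of the null-space shows that
    \<open>?q\<close> vanishes at \<open>x0\<close>.\<close>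
  have "?q (x0 + 0) = ?q 0" using x0(1) unfolding null_space_def by blast
  then have x00: "fst x0 $ j + snd x0 $ k = 0" for j k
    using weighted_form_eq_0_iff[where w = w and x = x0, OF wpos] by (simp add: q weighted_form_def[of w 0])
  \<comment> \<open>A nonzero zero of the form has the shape (c, ..., c; -c, ..., -c) with c
    \<noteq> 0. If it lay in \<open>L\<close>, so would its multiple \<open>x0\<close>.\<close>
  have pos: "0 < weighted_form w x x" if "x \<in> L" "x \<noteq> 0" for x
  proof (rule ccontr)
    assume "\<not> 0 < weighted_form w x x"
    then have "weighted_form w x x = 0"
      using weighted_form_nonneg[where w = w and x = x, OF wpos] by simp
    then have x: "fst x $ j + snd x $ k = 0" for j k
      using weighted_form_eq_0_iff[where w = w and x = x, OF wpos] by simp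
    define c where "c = fst x $ undefined"
    define c0 where "c0 = fst x0 $ undefined"
    note X = flat[OF x c_def] and X0 = flat[OF x00 c0_def]
    have "c \<noteq> 0" using that(2) X by (auto simp: prod_eq_iff vec_eq_iff)
    then have "x0 = (c0 / c) *\<^sub>R x"
      using X X0 by (auto simp: prod_eq_iff vec_eq_iff)
    then show False using x0(2) that(1) assms(12) by (simp add: subspace_scale)
  qed
  interpret positive_form_on_subspace L "weighted_form w" ?q
  proof (rule positive_form_on_subspace.intro)
    show "weighted_form w x y = weighted_form w y x" for x y
      by (simp add: weighted_form_def mult_ac)
  qed (fact assms(12) bounded_bilinear_weighted_form pos q)+
  have inner_w0: "x \<bullet> w0 j k = fst x $ j + snd x $ k" for x j k
    by (cases x) (simp add: w0_def inner_axis)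
  have B0: "weighted_form w x0 y = 0" for y
    by (simp add: weighted_form_def x00)
  have E: "(\<integral>(s, t). (s $ j1 + t $ k1) * (s $ j2 + t $ k2) \<partial>\<mu>)
      = fst (cov (w0 j1 k1)) $ j2 + snd (cov (w0 j1 k1)) $ k2" for j1 j2 k1 k2
  proof -
    have "linear (\<lambda>x :: (real^'m) \<times> (real^'n). fst x $ j2 + snd x $ k2)"
      by (auto intro!: linearI simp: algebra_simps)
    from linear_cov[OF this, of "w0 j1 k1"] show ?thesis
      by (simp add: inner_w0 assms(15) case_prod_unfold)
  qed
  have "dim L + 1 = DIM((real^'m) \<times> (real^'n))"
    using assms(13) by simp
  \<comment> \<open>The functional \<open>w0 j k\<close> is orthogonal to \<open>x0\<close> because
    \<open>x00\<close> makes its value there 0.\<close>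
  then have cov: "weighted_form w v (cov (w0 j k)) = v \<bullet> w0 j k" for v j k
    using B_cov_complement x0(2) B0 by (simp add: inner_w0 x00)
  have a: "a j = (\<Sum>k\<in>UNIV. w j k)" and b: "b k = (\<Sum>j\<in>UNIV. w j k)" for j k
    by (simp_all add: assms(9,10) w_def)
  \<comment> \<open>The contraction argument yields 2 / \<delta>^6; since \<delta> \<le> 1, this is
    below 12 / \<delta>^(15/2).\<close>
  have \<Delta>: "2 / ((\<delta>\<^sup>2) ^ 3 * W * real CARD('m) * real CARD('n)) \<le> \<Delta>"
  proof -
    have "\<delta> powr (15/2) \<le> \<delta> powr 6"
      using assms(4) \<delta>1 by (intro powr_mono') auto
    also have "\<dots> = (\<delta>\<^sup>2) ^ 3"
      using assms(4) by (simp add: powr_numeral flip: power_mult)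
    finally show ?thesis
      unfolding assms(11) W_def[symmetric] using assms(4) W
      by (intro frac_le mult_right_mono) auto
  qed
  \<comment> \<open>The two indicator terms let this one estimate cover all four cases of coinciding
    or distinct indices.\<close>
  have main: "\<bar>(\<integral>(s, t). (s $ j1 + t $ k1) * (s $ j2 + t $ k2) \<partial>\<mu>)
      - (if j2 = j1 then 1 / a j1 else 0) - (if k2 = k1 then 1 / b k1 else 0)\<bar> \<le> \<Delta>" for j1 j2 k1 k2
    unfolding E w0_def
    by (rule order_trans[OF bipartite_covariance_bound[OF Ww wW \<rho> W cov[unfolded w0_def] a b] \<Delta>])
  show ?thesis
  proof (intro conjI allI impI)
    show "\<bar>\<integral>(s, t). (s $ j1 + t $ k1) * (s $ j2 + t $ k2) \<partial>\<mu>\<bar> \<le> \<Delta>"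
      if "j1 \<noteq> j2" "k1 \<noteq> k2" for j1 j2 k1 k2
      using main[of j1 k1 j2 k2] that by simp
    show "\<bar>(\<integral>(s, t). (s $ j + t $ k1) * (s $ j + t $ k2) \<partial>\<mu>) - 1 / a j\<bar> \<le> \<Delta>"
      if "k1 \<noteq> k2" for j k1 k2
      using main[of j k1 j k2] that by simp
    show "\<bar>(\<integral>(s, t). (s $ j1 + t $ k) * (s $ j2 + t $ k) \<partial>\<mu>) - 1 / b k\<bar> \<le> \<Delta>"
      if "j1 \<noteq> j2" for j1 j2 k
      using main[of j1 k j2 k] that by simp
    show "\<bar>(\<integral>(s, t). (s $ j + t $ k)\<^sup>2 \<partial>\<mu>) - 1 / a j - 1 / b k\<bar> \<le> \<Delta>" for j k
      using main[of j k j k] by (simp add: power2_eq_square)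
  qed
qed

end
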